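(* If $G$ is a $\gamma_{tR}$-edge-supercritical graph, then every edge $e\in E(G)$ not incident with a vertex of degree $1$ satisfies $\gamma_{tR}(G-e)=\gamma_{tR}(G)$.
   Context: All graphs are finite and simple. A total Roman dominating function (TRD-function) on a graph $G$ with no isolated vertices is a function $f:V(G)\to\{0,1,2\}$ such that every vertex $v$ with $f(v)=0$ is adjacent to some $u$ with $f(u)=2$, and the subgraph induced by $\{w:f(w)>0\}$ has no isolated vertices; its weight is $\sum_v f(v)$ and $\gamma_{tR}(G)$ is the minimum weight. A graph $G$ with no isolated vertices is $\gamma_{tR}$-edge-supercritical if $E(\overline{G})\neq\emptyset$ and $\gamma_{tR}(G+e)\leq\gamma_{tR}(G)-2$ for every $e\in E(\overline{G})$. *)

theory Defs
  imports Main "HOL-Library.FuncSet"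
begin

(* A graph is given by its vertex set V and its set E of edges, each edge being
   an unordered pair, i.e. a two-element set of vertices. *)

definition all_pairs :: "'a set \<Rightarrow> 'a set set" where
  "all_pairs V = {e. e \<subseteq> V \<and> card e = 2}"

definition fin_simple_graph :: "'a set \<Rightarrow> 'a set set \<Rightarrow> bool" where
  "fin_simple_graph V E \<longleftrightarrow> finite V \<and> E \<subseteq> all_pairs V"

definition complement_edges :: "'a set \<Rightarrow> 'a set set \<Rightarrow> 'a set set" where
  "complement_edges V E = all_pairs V - E"

definition adjacent :: "'a set set \<Rightarrow> 'a \<Rightarrow> 'a \<Rightarrow> bool" where
  "adjacent E u v \<longleftrightarrow> {u, v} \<in> E"

definition vdegree :: "'a set set \<Rightarrow> 'a \<Rightarrow> nat" where
  "vdegree E v = card {e \<in> E. v \<in> e}"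

definition no_isolated :: "'a set \<Rightarrow> 'a set set \<Rightarrow> bool" where
  "no_isolated V E \<longleftrightarrow> (\<forall>v\<in>V. \<exists>u\<in>V. adjacent E u v)"

definition induced_edges :: "'a set set \<Rightarrow> 'a set \<Rightarrow> 'a set set" where
  "induced_edges E W = {e \<in> E. e \<subseteq> W}"

definition TRD_function :: "'a set \<Rightarrow> 'a set set \<Rightarrow> ('a \<Rightarrow> nat) \<Rightarrow> bool" where
  "TRD_function V E f \<longleftrightarrow>
     f \<in> V \<rightarrow> {0, 1, 2} \<and>
     (\<forall>v\<in>V. f v = 0 \<longrightarrow> (\<exists>u\<in>V. adjacent E u v \<and> f u = 2)) \<and>
     no_isolated {w \<in> V. f w > 0} (induced_edges E {w \<in> V. f w > 0})"

definition weight :: "'a set \<Rightarrow> ('a \<Rightarrow> nat) \<Rightarrow> nat" where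
  "weight V f = (\<Sum>v\<in>V. f v)"

(* Meaningful for finite graphs without isolated vertices: there the constant
   function 1 is a TRD-function, so the minimum exists. *)
definition gamma_tR :: "'a set \<Rightarrow> 'a set set \<Rightarrow> nat" where
  "gamma_tR V E = (LEAST w. \<exists>f. TRD_function V E f \<and> w = weight V f)"

(* The drop by 2 is written additively to avoid truncated subtraction. *)
definition edge_supercritical :: "'a set \<Rightarrow> 'a set set \<Rightarrow> bool" where
  "edge_supercritical V E \<longleftrightarrow>
     fin_simple_graph V E \<and> no_isolated V E \<and>
     complement_edges V E \<noteq> {} \<and>
     (\<forall>e\<in>complement_edges V E. gamma_tR V (insert e E) + 2 \<le> gamma_tR V E)"

end

theory Submission
  imports Defs
begin

text \<open>
  Let \<open>xy\<close> be a nonedge whose ends have a common neighbour, and let \<open>g\<close> be a minimum TRD-function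
  of \<open>G + xy\<close>. Its weight is at most \<open>\<gamma>(G) - 2\<close>, so \<open>g\<close> cannot be repaired in \<open>G\<close> at cost \<open>1\<close>; this
  forces, up to symmetry, \<open>g x = 2\<close>, \<open>g y = 0\<close> and \<open>g = 0\<close> on the neighbours of \<open>y\<close>. Raising \<open>y\<close> and
  an arbitrary neighbour of \<open>y\<close> to \<open>1\<close> repairs \<open>g\<close> at cost \<open>2\<close>. Given an edge \<open>uv\<close>, this freedom
  yields a TRD-function of \<open>G - uv\<close> of weight \<open>\<gamma>(G)\<close> whenever some \<open>w\<close> is adjacent to exactly one
  of \<open>u\<close>, \<open>v\<close> (use the nonedge between \<open>w\<close> and the other one) or two common neighbours of \<open>u\<close>, \<open>v\<close>
  are nonadjacent (use that nonedge). Otherwise \<open>u\<close> and \<open>v\<close> are twins whose closed neighbourhood is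
  a clique, and weight can be shifted from \<open>u\<close> and \<open>v\<close> to another vertex of the clique.
\<close>

section \<open>TRD-functions in pointwise form, and their minimum weight\<close>

text \<open>The condition on the induced subgraph becomes local: each positive vertex has a positive
  neighbour. After changing a few values, only the witnesses at each vertex have to be
  checked.\<close>

lemma TRD_function_iff:
  "TRD_function V E f \<longleftrightarrow>
     (\<forall>v\<in>V. f v \<le> 2) \<and>
     (\<forall>v\<in>V. f v = 0 \<longrightarrow> (\<exists>u\<in>V. {u, v} \<in> E \<and> f u = 2)) \<and>
     (\<forall>v\<in>V. 0 < f v \<longrightarrow> (\<exists>u\<in>V. {u, v} \<in> E \<and> 0 < f u))"
proof -
  have "f \<in> V \<rightarrow> {0, 1, 2} \<longleftrightarrow> (\<forall>v\<in>V. f v \<le> 2)"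
    by (auto simp: Pi_iff le_Suc_eq numeral_2_eq_2)
  moreover have "no_isolated {w \<in> V. f w > 0} (induced_edges E {w \<in> V. f w > 0}) \<longleftrightarrow>
     (\<forall>v\<in>V. 0 < f v \<longrightarrow> (\<exists>u\<in>V. {u, v} \<in> E \<and> 0 < f u))"
    unfolding no_isolated_def induced_edges_def adjacent_def by auto
  ultimately show ?thesis
    unfolding TRD_function_def adjacent_def by simp
qed

lemma TRD_functionI:
  assumes "\<And>v. v \<in> V \<Longrightarrow> f v \<le> 2"
    and "\<And>v. v \<in> V \<Longrightarrow> f v = 0 \<Longrightarrow> \<exists>u\<in>V. {u, v} \<in> E \<and> f u = 2"
    and "\<And>v. v \<in> V \<Longrightarrow> 0 < f v \<Longrightarrow> \<exists>u\<in>V. {u, v} \<in> E \<and> 0 < f u"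
  shows "TRD_function V E f"
  using assms by (simp add: TRD_function_iff)

lemma TRD_function_le_2: "TRD_function V E f \<Longrightarrow> v \<in> V \<Longrightarrow> f v \<le> 2"
  by (simp add: TRD_function_iff)

lemma TRD_function_zeroE:
  assumes "TRD_function V E f" "v \<in> V" "f v = 0"
  obtains u where "u \<in> V" "{u, v} \<in> E" "f u = 2"
  using assms by (auto simp: TRD_function_iff)

lemma TRD_function_posE:
  assumes "TRD_function V E f" "v \<in> V" "0 < f v"
  obtains u where "u \<in> V" "{u, v} \<in> E" "0 < f u"
  using assms by (auto simp: TRD_function_iff)

lemma TRD_function_mono:
  "TRD_function V E f \<Longrightarrow> E \<subseteq> E' \<Longrightarrow> TRD_function V E' f"
  unfolding TRD_function_iff by (meson subsetD)

lemma gamma_tR_le: "TRD_function V E f \<Longrightarrow> gamma_tR V E \<le> weight V f"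
  unfolding gamma_tR_def by (rule Least_le) auto

text \<open>Some TRD-function must be supplied, since \<open>LEAST\<close> over an empty set of
  weights says nothing.\<close>

lemma gamma_tR_attained:
  assumes "TRD_function V E f"
  obtains g where "TRD_function V E g" "weight V g = gamma_tR V E"
proof -
  have "\<exists>w g. TRD_function V E g \<and> w = weight V g"
    using assms by blast
  from LeastI_ex[OF this] show thesis
    using that unfolding gamma_tR_def by metis
qed

lemma TRD_function_one: "no_isolated V E \<Longrightarrow> TRD_function V E (\<lambda>_. 1)"
  unfolding TRD_function_iff no_isolated_def adjacent_def by simp

text \<open>The additive form avoids truncated subtraction, so chains of updates can be left to
  linear arithmetic.\<close>

lemma weight_upd:
  assumes "finite V" "x \<in> V"
  shows "weight V (f(x := a)) + f x = weight V f + a"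
proof -
  have "(\<Sum>v\<in>V - {x}. (f(x := a)) v) = (\<Sum>v\<in>V - {x}. f v)"
    by (rule sum.cong) auto
  then show ?thesis
    unfolding weight_def using assms by (simp add: sum.remove)
qed

section \<open>Adding a nonedge between two neighbours of a vertex\<close>

text \<open>Every repair of cost at most 1 is excluded, so \<open>xy\<close> must serve to dominate
  one end from the other, and the dominated end must have no positive neighbour in \<open>E\<close>.
  The common neighbour \<open>u\<close> excludes the case where both ends are positive.\<close>

lemma supercritical_common_neighbour:
  assumes crit: "edge_supercritical V E"
    and xy: "x \<in> V" "y \<in> V" "x \<noteq> y" "{x, y} \<notin> E"
    and u: "u \<in> V" "{u, x} \<in> E" "{u, y} \<in> E"
  obtains (left) g where "TRD_function V (insert {x, y} E) g" "weight V g + 2 \<le> gamma_tR V E"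
      "g x = 2" "g y = 0" "\<And>z. z \<in> V \<Longrightarrow> {z, y} \<in> E \<Longrightarrow> g z = 0"
    | (right) g where "TRD_function V (insert {x, y} E) g" "weight V g + 2 \<le> gamma_tR V E"
      "g y = 2" "g x = 0" "\<And>z. z \<in> V \<Longrightarrow> {z, x} \<in> E \<Longrightarrow> g z = 0"
proof -
  let ?E = "insert {x, y} E"
  have fin: "finite V" and iso: "no_isolated V E"
    using crit by (auto simp: edge_supercritical_def fin_simple_graph_def)
  have "{x, y} \<in> complement_edges V E"
    using xy by (auto simp: complement_edges_def all_pairs_def)
  then have drop: "gamma_tR V ?E + 2 \<le> gamma_tR V E"
    using crit by (auto simp: edge_supercritical_def)
  have "TRD_function V ?E (\<lambda>_. 1)"
    using TRD_function_one[OF iso] by (rule TRD_function_mono) auto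
  then obtain g where g: "TRD_function V ?E g" and "weight V g = gamma_tR V ?E"
    by (rule gamma_tR_attained)
  with drop have wg: "weight V g + 2 \<le> gamma_tR V E" by simp
  \<comment> \<open>The source of all contradictions below: a TRD-function of \<open>G\<close>
    weighs at least \<open>weight V g + 2\<close>.\<close>
  have small: False if "TRD_function V E h" "weight V h \<le> weight V g + 1" for h
    using gamma_tR_le[OF that(1)] that(2) wg by linarith
  \<comment> \<open>The values at \<open>x\<close> and \<open>y\<close> are then 0,0 or 0,1 in some
    order, so \<open>xy\<close> is a witness for no vertex and \<open>g\<close> already works in
    \<open>G\<close>.\<close>
  have unused: False
    if "\<not> (0 < g x \<and> 0 < g y)" "\<not> (g x = 2 \<and> g y = 0)" "\<not> (g y = 2 \<and> g x = 0)"
  proof (rule small)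
    show "TRD_function V E g"
    proof (rule TRD_functionI)
      fix v assume "v \<in> V"
      then show "g v \<le> 2" using TRD_function_le_2[OF g] by simp
    next
      fix v assume v: "v \<in> V" "g v = 0"
      then obtain t where t: "t \<in> V" "{t, v} \<in> ?E" "g t = 2" using g TRD_function_zeroE by metis
      then have "{t, v} \<in> E" using that v by (auto simp: doubleton_eq_iff)
      then show "\<exists>t\<in>V. {t, v} \<in> E \<and> g t = 2" using t by blast
    next
      fix v assume v: "v \<in> V" "0 < g v"
      then obtain t where t: "t \<in> V" "{t, v} \<in> ?E" "0 < g t" using g TRD_function_posE by metis
      then have "{t, v} \<in> E" using that v by (auto simp: doubleton_eq_iff)
      then show "\<exists>t\<in>V. {t, v} \<in> E \<and> 0 < g t" using t by blast
    qed
  qed simp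
  have both: False if "0 < g x" "0 < g y"
  proof (rule small)
    \<comment> \<open>With both ends positive, \<open>xy\<close> can only provide positive
      neighbours for \<open>x\<close> and \<open>y\<close>. A positive \<open>u\<close> takes over
      for both, and \<open>x\<close> serves \<open>u\<close>; \<open>max\<close> preserves a value 2
      at \<open>u\<close>.\<close>
    let ?h = "g(u := max (g u) 1)"
    have h_pos: "0 < g v \<Longrightarrow> 0 < ?h v" and h_two: "g v = 2 \<Longrightarrow> ?h v = 2" for v by auto
    show "TRD_function V E ?h"
    proof (rule TRD_functionI)
      fix v assume v: "v \<in> V"
      show "?h v \<le> 2" using TRD_function_le_2[OF g v] by auto
    next
      fix v assume v: "v \<in> V" "?h v = 0"
      then have "g v = 0" by (auto split: if_splits)
      then obtain t where t: "t \<in> V" "{t, v} \<in> ?E" "g t = 2" using g v TRD_function_zeroE by metis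
      have "{t, v} \<in> E" using t that \<open>g v = 0\<close> by (auto simp: doubleton_eq_iff)
      then show "\<exists>t\<in>V. {t, v} \<in> E \<and> ?h t = 2" using t h_two by blast
    next
      fix v assume v: "v \<in> V" "0 < ?h v"
      show "\<exists>t\<in>V. {t, v} \<in> E \<and> 0 < ?h t"
      proof (cases "v = x \<or> v = y \<or> v = u")
        case True
        then consider "v = x \<or> v = y" | "v = u" by blast
        then show ?thesis
        proof cases
          case 1
          then show ?thesis using u by (intro bexI[of _ u]) auto
        next
          case 2
          then show ?thesis using u xy that by (intro bexI[of _ x]) (auto simp: insert_commute)
        qed
      next
        case False
        with v have "0 < g v" by simp
        then obtain t where t: "t \<in> V" "{t, v} \<in> ?E" "0 < g t" using g v TRD_function_posE by metis
        have "{t, v} \<in> E" using t False by (auto simp: doubleton_eq_iff)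
        then show ?thesis using t h_pos by blast
      qed
    qed
    show "weight V ?h \<le> weight V g + 1"
      using weight_upd[OF fin u(1), of g "max (g u) 1"] by linarith
  qed
  \<comment> \<open>Without \<open>xy\<close> only \<open>b\<close> loses its witness. If
    \<open>b\<close> had a positive neighbour \<open>z\<close>, raising \<open>b\<close> to 1 would
    suffice. The names \<open>a\<close>, \<open>b\<close> cover both orientations of
    \<open>xy\<close>.\<close>
  have nbrs: "g z = 0"
    if ab: "{x, y} = {a, b}" "g a = 2" "g b = 0" and z: "z \<in> V" "{z, b} \<in> E" for a b z
  proof (rule ccontr)
    assume gz: "g z \<noteq> 0"
    have b: "b \<in> V" using xy ab by (auto simp: doubleton_eq_iff)
    let ?h = "g(b := 1)"
    have "TRD_function V E ?h"
    proof (rule TRD_functionI)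
      fix v assume v: "v \<in> V"
      show "?h v \<le> 2" using TRD_function_le_2[OF g v] by simp
    next
      fix v assume v: "v \<in> V" "?h v = 0"
      then have "g v = 0" "v \<noteq> b" by (auto split: if_splits)
      then obtain t where t: "t \<in> V" "{t, v} \<in> ?E" "g t = 2" using g v TRD_function_zeroE by metis
      have "{t, v} \<in> E" "t \<noteq> b"
        using t ab \<open>g v = 0\<close> \<open>v \<noteq> b\<close> by (auto simp: doubleton_eq_iff)
      then show "\<exists>t\<in>V. {t, v} \<in> E \<and> ?h t = 2" using t by auto
    next
      fix v assume v: "v \<in> V" "0 < ?h v"
      show "\<exists>t\<in>V. {t, v} \<in> E \<and> 0 < ?h t"
      proof (cases "v = b")
        case True
        then show ?thesis using z gz by (intro bexI[of _ z]) auto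
      next
        case False
        with v have "0 < g v" by simp
        then obtain t where t: "t \<in> V" "{t, v} \<in> ?E" "0 < g t" using g v TRD_function_posE by metis
        have "{t, v} \<in> E" using t False ab by (auto simp: doubleton_eq_iff)
        then show ?thesis using t by auto
      qed
    qed
    then show False
      by (rule small) (use weight_upd[OF fin b, of g 1] in linarith)
  qed
  consider "g x = 2" "g y = 0" | "g y = 2" "g x = 0"
    using unused both by metis
  then show thesis
  proof cases
    case 1
    then show thesis using left[OF g wg] nbrs[of x y] by blast
  next
    case 2
    then show thesis using right[OF g wg] nbrs[of y x] by blast
  qed
qed

section \<open>Removing an edge: the three configurations around its ends\<close>

text \<open>The nonedge \<open>wv\<close> has the common neighbour \<open>u\<close>. In both
  outcomes \<open>u\<close> is adjacent to the dominated end, so \<open>g u = 0\<close>, and the two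
  spare units of weight can be placed on an edge other than \<open>uv\<close>.\<close>

lemma supercritical_remove_edge_non_twins:
  assumes crit: "edge_supercritical V E"
    and uv: "u \<in> V" "v \<in> V" "u \<noteq> v" "{u, v} \<in> E"
    and w: "w \<in> V" "{u, w} \<in> E" "{w, v} \<notin> E" "w \<noteq> v"
    and z: "z \<in> V" "{z, v} \<in> E" "z \<noteq> u"
  shows "\<exists>f. TRD_function V (E - {{u, v}}) f \<and> weight V f \<le> gamma_tR V E"
proof -
  have fin: "finite V" and loop: "\<And>x. {x} \<notin> E"
    using crit by (auto simp: edge_supercritical_def fin_simple_graph_def all_pairs_def)
  have ne: "w \<noteq> u" "z \<noteq> v" using w z loop by auto
  show ?thesis
  proof (cases rule: supercritical_common_neighbour[OF crit w(1) uv(2) w(4,3) uv(1) w(2) uv(4)])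
    case (1 g)
    note left = this
    \<comment> \<open>Here \<open>v\<close> loses its dominator \<open>w\<close>; since
      \<open>z \<noteq> u\<close>, the edge \<open>zv\<close> survives and makes \<open>v\<close>
      and \<open>z\<close> partners. As \<open>u\<close> and \<open>v\<close> both have value 0
      under \<open>g\<close>, neither is a witness for any vertex.\<close>
    let ?f = "g(v := 1, z := 1)"
    have gz: "g z = 0" "g u = 0" using left(5) z uv by auto
    have "TRD_function V (E - {{u, v}}) ?f"
    proof (rule TRD_functionI)
      fix a assume "a \<in> V"
      then show "?f a \<le> 2" using TRD_function_le_2[OF left(1)] by simp
    next
      fix a assume a: "a \<in> V" "?f a = 0"
      then have "g a = 0" "a \<noteq> v" "a \<noteq> z" by (auto split: if_splits)
      then obtain t where t: "t \<in> V" "{t, a} \<in> insert {w, v} E" "g t = 2"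
        using left(1) a TRD_function_zeroE by metis
      have "t \<noteq> v" "t \<noteq> z" "t \<noteq> u" using t gz left by auto
      then show "\<exists>t\<in>V. {t, a} \<in> E - {{u, v}} \<and> ?f t = 2"
        using t \<open>a \<noteq> v\<close> by (intro bexI[of _ t]) (auto simp: doubleton_eq_iff)
    next
      fix a assume a: "a \<in> V" "0 < ?f a"
      consider "a = v" | "a = z" | "a \<noteq> v" "a \<noteq> z" by blast
      then show "\<exists>t\<in>V. {t, a} \<in> E - {{u, v}} \<and> 0 < ?f t"
      proof cases
        case 1
        then show ?thesis using z ne by (intro bexI[of _ z]) (auto simp: doubleton_eq_iff)
      next
        case 2
        then show ?thesis using z ne uv
          by (intro bexI[of _ v]) (auto simp: doubleton_eq_iff insert_commute)
      next
        case 3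
        with a have "0 < g a" by simp
        then obtain t where t: "t \<in> V" "{t, a} \<in> insert {w, v} E" "0 < g t"
          using left(1) a TRD_function_posE by metis
        have "t \<noteq> v" "t \<noteq> z" "t \<noteq> u" using t gz left by auto
        then show ?thesis
          using t 3 by (intro bexI[of _ t]) (auto simp: doubleton_eq_iff)
      qed
    qed
    moreover have "weight V ?f \<le> gamma_tR V E"
      using weight_upd[OF fin uv(2), of g 1] weight_upd[OF fin z(1), of "g(v := 1)" 1] left(2)
      by linarith
    ultimately show ?thesis by blast
  next
    case (2 g)
    note right = this
    \<comment> \<open>The edge \<open>uw\<close> survives and makes \<open>u\<close> and
      \<open>w\<close> partners. A positive \<open>u\<close> no longer has to be dominated by
      \<open>v\<close>, and the positive neighbour of \<open>v\<close> under \<open>g\<close> was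
      not \<open>u\<close>.\<close>
    let ?f = "g(w := 1, u := 1)"
    have gz: "g u = 0" using right(5) uv w by auto
    have "TRD_function V (E - {{u, v}}) ?f"
    proof (rule TRD_functionI)
      fix a assume "a \<in> V"
      then show "?f a \<le> 2" using TRD_function_le_2[OF right(1)] by simp
    next
      fix a assume a: "a \<in> V" "?f a = 0"
      then have "g a = 0" "a \<noteq> u" "a \<noteq> w" by (auto split: if_splits)
      then obtain t where t: "t \<in> V" "{t, a} \<in> insert {w, v} E" "g t = 2"
        using right(1) a TRD_function_zeroE by metis
      have "t \<noteq> u" "t \<noteq> w" using t gz right by auto
      then show "\<exists>t\<in>V. {t, a} \<in> E - {{u, v}} \<and> ?f t = 2"
        using t \<open>a \<noteq> u\<close> \<open>a \<noteq> w\<close> by (intro bexI[of _ t]) (auto simp: doubleton_eq_iff)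
    next
      fix a assume a: "a \<in> V" "0 < ?f a"
      consider "a = u" | "a = w" | "a \<noteq> u" "a \<noteq> w" by blast
      then show "\<exists>t\<in>V. {t, a} \<in> E - {{u, v}} \<and> 0 < ?f t"
      proof cases
        case 1
        then show ?thesis using w ne uv
          by (intro bexI[of _ w]) (auto simp: doubleton_eq_iff insert_commute)
      next
        case 2
        then show ?thesis using w ne uv by (intro bexI[of _ u]) (auto simp: doubleton_eq_iff)
      next
        case 3
        with a have "0 < g a" by simp
        then obtain t where t: "t \<in> V" "{t, a} \<in> insert {w, v} E" "0 < g t"
          using right(1) a TRD_function_posE by metis
        have "t \<noteq> u" "t \<noteq> w" using t gz right by auto
        then show ?thesis
          using t 3 by (intro bexI[of _ t]) (auto simp: doubleton_eq_iff)
      qed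
    qed
    moreover have "weight V ?f \<le> gamma_tR V E"
      using weight_upd[OF fin w(1), of g 1] weight_upd[OF fin uv(1), of "g(w := 1)" 1] right(2)
      by linarith
    ultimately show ?thesis by blast
  qed
qed

text \<open>Whichever of \<open>x\<close>, \<open>y\<close> is the dominated end, both
  \<open>u\<close> and \<open>v\<close> are its neighbours and have value 0, so \<open>uv\<close> is
  no witness. Raising that end and \<open>u\<close> uses an edge other than
  \<open>uv\<close>.\<close>

lemma supercritical_remove_edge_nonadjacent_common_neighbours:
  assumes crit: "edge_supercritical V E"
    and uv: "u \<in> V" "v \<in> V" "u \<noteq> v" "{u, v} \<in> E"
    and x: "x \<in> V" "{u, x} \<in> E" "{v, x} \<in> E"
    and y: "y \<in> V" "{u, y} \<in> E" "{v, y} \<in> E"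
    and xy: "x \<noteq> y" "{x, y} \<notin> E"
  shows "\<exists>f. TRD_function V (E - {{u, v}}) f \<and> weight V f \<le> gamma_tR V E"
proof -
  have fin: "finite V" and loop: "\<And>x. {x} \<notin> E"
    using crit by (auto simp: edge_supercritical_def fin_simple_graph_def all_pairs_def)
  have repair: ?thesis
    if g: "TRD_function V (insert {a, b} E) g" "weight V g + 2 \<le> gamma_tR V E"
      "g a = 2" "g b = 0" "\<And>z. z \<in> V \<Longrightarrow> {z, b} \<in> E \<Longrightarrow> g z = 0"
      and a: "a \<in> V" "{u, a} \<in> E" "{v, a} \<in> E"
      and b: "b \<in> V" "{u, b} \<in> E" "{v, b} \<in> E" for a b g
  proof -
    let ?f = "g(b := 1, u := 1)"
    have ne: "a \<noteq> u" "a \<noteq> v" "b \<noteq> u" "b \<noteq> v" using a b loop by auto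
    have gz: "g u = 0" "g v = 0" using g(5) uv b by auto
    have "TRD_function V (E - {{u, v}}) ?f"
    proof (rule TRD_functionI)
      fix c assume "c \<in> V"
      then show "?f c \<le> 2" using TRD_function_le_2[OF g(1)] by simp
    next
      fix c assume c: "c \<in> V" "?f c = 0"
      then have "g c = 0" "c \<noteq> u" "c \<noteq> b" by (auto split: if_splits)
      then obtain t where t: "t \<in> V" "{t, c} \<in> insert {a, b} E" "g t = 2"
        using g(1) c TRD_function_zeroE by metis
      have "t \<noteq> u" "t \<noteq> b" "t \<noteq> v" using t gz g by auto
      then show "\<exists>t\<in>V. {t, c} \<in> E - {{u, v}} \<and> ?f t = 2"
        using t \<open>c \<noteq> u\<close> \<open>c \<noteq> b\<close> by (intro bexI[of _ t]) (auto simp: doubleton_eq_iff)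
    next
      fix c assume c: "c \<in> V" "0 < ?f c"
      consider "c = u" | "c = b" | "c \<noteq> u" "c \<noteq> b" by blast
      then show "\<exists>t\<in>V. {t, c} \<in> E - {{u, v}} \<and> 0 < ?f t"
      proof cases
        case 1
        then show ?thesis using b ne uv
          by (intro bexI[of _ b]) (auto simp: doubleton_eq_iff insert_commute)
      next
        case 2
        then show ?thesis using b ne uv by (intro bexI[of _ u]) (auto simp: doubleton_eq_iff)
      next
        case 3
        with c have "0 < g c" by simp
        then obtain t where t: "t \<in> V" "{t, c} \<in> insert {a, b} E" "0 < g t"
          using g(1) c TRD_function_posE by metis
        have "t \<noteq> u" "t \<noteq> b" "t \<noteq> v" using t gz g by auto
        then show ?thesis
          using t 3 by (intro bexI[of _ t]) (auto simp: doubleton_eq_iff)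
      qed
    qed
    moreover have "weight V ?f \<le> gamma_tR V E"
      using weight_upd[OF fin b(1), of g 1] weight_upd[OF fin uv(1), of "g(b := 1)" 1] g(2)
      by linarith
    ultimately show ?thesis by blast
  qed
  show ?thesis
  proof (cases rule: supercritical_common_neighbour[OF crit x(1) y(1) xy uv(1) x(2) y(2)])
    case (1 g)
    then show ?thesis using repair[of x y g] x y by blast
  next
    case (2 g)
    then show ?thesis using repair[of y x g] x y by (simp add: insert_commute)
  qed
qed

text \<open>A vertex \<open>w\<close> of the clique other than \<open>u\<close>, \<open>v\<close>
  sees everything that \<open>u\<close> or \<open>v\<close> sees. If \<open>u\<close>,
  \<open>v\<close> and some such \<open>w\<close> carry weight at least 3 together, \<open>w\<close>
  can take over with value 2; otherwise so little weight lies there that \<open>uv\<close> is idle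
  or the weight of its ends can be moved to \<open>z\<close>.\<close>

lemma remove_edge_clique:
  assumes graph: "fin_simple_graph V E"
    and uv: "u \<in> V" "v \<in> V" "u \<noteq> v" "{u, v} \<in> E"
    and z: "z \<in> V" "{u, z} \<in> E" "z \<noteq> v"
    and twins: "\<And>w. w \<in> V \<Longrightarrow> w \<noteq> u \<Longrightarrow> w \<noteq> v \<Longrightarrow> {u, w} \<in> E \<longleftrightarrow> {v, w} \<in> E"
    and clique: "\<And>x y. x \<in> V \<Longrightarrow> y \<in> V \<Longrightarrow> x \<noteq> y \<Longrightarrow> {u, x} \<in> E \<Longrightarrow> {u, y} \<in> E \<Longrightarrow> {x, y} \<in> E"
    and f: "TRD_function V E f"
  shows "\<exists>h. TRD_function V (E - {{u, v}}) h \<and> weight V h \<le> weight V f"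
proof -
  have fin: "finite V" and loop: "\<And>x. {x} \<notin> E"
    using graph by (auto simp: fin_simple_graph_def all_pairs_def)
  have zu: "z \<noteq> u" using z loop by auto
  show ?thesis
  proof (cases "\<exists>w\<in>V. w \<noteq> v \<and> {u, w} \<in> E \<and> 3 \<le> f u + f v + f w")
    case True
    then obtain w where w: "w \<in> V" "w \<noteq> v" "{u, w} \<in> E" "3 \<le> f u + f v + f w" by blast
    have wu: "w \<noteq> u" using w loop by auto
    \<comment> \<open>\<open>w\<close> is joined to all other vertices of the common closed
      neighbourhood, never through \<open>uv\<close>, so it can replace \<open>u\<close> and
      \<open>v\<close> as a witness.\<close>
    have dom: "{w, a} \<in> E - {{u, v}}"
      if "a \<in> V" "a \<noteq> w" "a = u \<or> a = v \<or> {u, a} \<in> E \<or> {v, a} \<in> E" for a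
    proof -
      have "{u, a} \<in> E \<or> a = u" using that uv twins by metis
      then have "{w, a} \<in> E" using clique[of w a] that w by (auto simp: insert_commute)
      then show ?thesis using w wu by (auto simp: doubleton_eq_iff)
    qed
    \<comment> \<open>The new values sum to 3, the available weight; \<open>u\<close> keeps 1 as the
      positive neighbour of \<open>w\<close>.\<close>
    let ?h = "f(v := 0, u := 1, w := 2)"
    have "TRD_function V (E - {{u, v}}) ?h"
    proof (rule TRD_functionI)
      fix a assume "a \<in> V"
      then show "?h a \<le> 2" using TRD_function_le_2[OF f] by simp
    next
      fix a assume a: "a \<in> V" "?h a = 0"
      then have aw: "a \<noteq> w" "a \<noteq> u" by (auto split: if_splits)
      show "\<exists>t\<in>V. {t, a} \<in> E - {{u, v}} \<and> ?h t = 2"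
      proof (cases "a = v \<or> {u, a} \<in> E \<or> {v, a} \<in> E")
        case True
        then have "{w, a} \<in> E - {{u, v}}" using dom a aw by blast
        then show ?thesis using w(1) by (intro bexI[of _ w]) auto
      next
        case False
        then have "f a = 0" using a by (auto split: if_splits)
        then obtain t where t: "t \<in> V" "{t, a} \<in> E" "f t = 2"
          using f a TRD_function_zeroE by metis
        then have "t \<noteq> u" "t \<noteq> v" using False by auto
        then show ?thesis using t aw by (intro bexI[of _ t]) (auto simp: doubleton_eq_iff)
      qed
    next
      fix a assume a: "a \<in> V" "0 < ?h a"
      then have av: "a \<noteq> v" using w uv by (auto split: if_splits)
      show "\<exists>t\<in>V. {t, a} \<in> E - {{u, v}} \<and> 0 < ?h t"
      proof (cases "a = w")
        case True
        then show ?thesis using uv w wu by (intro bexI[of _ u]) (auto simp: doubleton_eq_iff)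
      next
        case aw: False
        show ?thesis
        proof (cases "a = u \<or> {u, a} \<in> E \<or> {v, a} \<in> E")
          case True
          then have "{w, a} \<in> E - {{u, v}}" using dom a aw by blast
          then show ?thesis using w(1) by (intro bexI[of _ w]) auto
        next
          case False
          then have "0 < f a" using a aw av by (auto split: if_splits)
          then obtain t where t: "t \<in> V" "{t, a} \<in> E" "0 < f t"
            using f a TRD_function_posE by metis
          then have "t \<noteq> u" "t \<noteq> v" using False by auto
          then show ?thesis using t av False by (intro bexI[of _ t]) (auto simp: doubleton_eq_iff)
        qed
      qed
    qed
    moreover have "weight V ?h \<le> weight V f"
      using weight_upd[OF fin uv(2), of f 0] weight_upd[OF fin uv(1), of "f(v := 0)" 1]
        weight_upd[OF fin w(1), of "f(v := 0, u := 1)" 2] w wu uv(3) by simp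
    ultimately show ?thesis by blast
  next
    case False
    then have small: "f u + f v + f w \<le> 2" if "w \<in> V" "w \<noteq> v" "{u, w} \<in> E" for w
      using that by force
    have nbr: "\<exists>w\<in>V. w \<noteq> u \<and> w \<noteq> v \<and> {u, w} \<in> E \<and> {v, w} \<in> E \<and> 0 < f w"
      if "a = u \<or> a = v" "f a = 2" "f u + f v = 2" for a
    proof -
      have "a \<in> V" "0 < f a" using that uv by auto
      then obtain t where t: "t \<in> V" "{t, a} \<in> E" "0 < f t" using f TRD_function_posE by metis
      have "t \<noteq> u \<and> t \<noteq> v" using t that loop by auto
      then show ?thesis using t that twins[of t] by (auto simp: insert_commute)
    qed
    \<comment> \<open>A value 2 at one end uses up the bound 2, so the other end and all their
      common neighbours would be 0, leaving that end without a positive neighbour.\<close>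
    have not2: "f a \<noteq> 2" if a: "a = u \<or> a = v" for a
    proof
      assume "f a = 2"
      moreover have "f u + f v = 2" using small[OF z(1,3,2)] that \<open>f a = 2\<close> by auto
      ultimately obtain w where "w \<in> V" "w \<noteq> v" "{u, w} \<in> E" "0 < f w" using nbr[OF a] by blast
      then show False using small[of w] \<open>f u + f v = 2\<close> by simp
    qed
    show ?thesis
    proof (cases "0 < f u \<and> 0 < f v")
      case False
      \<comment> \<open>Both ends have value at most 1 and one has value 0, so \<open>uv\<close> is
        a witness for neither end.\<close>
      have "TRD_function V (E - {{u, v}}) f"
      proof (rule TRD_functionI)
        fix a assume "a \<in> V"
        then show "f a \<le> 2" using TRD_function_le_2[OF f] by simp
      next
        fix a assume "a \<in> V" "f a = 0"
        then obtain t where "t \<in> V" "{t, a} \<in> E" "f t = 2" using f TRD_function_zeroE by metis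
        then show "\<exists>t\<in>V. {t, a} \<in> E - {{u, v}} \<and> f t = 2"
          using not2 by (intro bexI[of _ t]) (auto simp: doubleton_eq_iff)
      next
        fix a assume a: "a \<in> V" "0 < f a"
        then obtain t where "t \<in> V" "{t, a} \<in> E" "0 < f t" using f TRD_function_posE by metis
        then show "\<exists>t\<in>V. {t, a} \<in> E - {{u, v}} \<and> 0 < f t"
          using False a by (intro bexI[of _ t]) (auto simp: doubleton_eq_iff)
      qed
      then show ?thesis by blast
    next
      case True
      then have one: "f u = 1" "f v = 1" using small[OF z(1,3,2)] by auto
      have zero: "f w = 0" if "w \<in> V" "w \<noteq> v" "{u, w} \<in> E" for w
        using small[OF that] one by simp
      have zero': "f w = 0" if "w \<in> V" "w \<noteq> u" "{v, w} \<in> E" for w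
        using zero[of w] twins[of w] that loop[of v] by (cases "w = v") auto
      \<comment> \<open>Since \<open>z\<close> has value 0 it has a dominator, which is neither
        \<open>u\<close> nor \<open>v\<close> because these have value 1. It becomes the positive
        neighbour of \<open>z\<close> below.\<close>
      obtain s where s: "s \<in> V" "{s, z} \<in> E" "f s = 2"
        using f z(1) zero[OF z(1,3,2)] TRD_function_zeroE by metis
      have sne: "s \<noteq> u" "s \<noteq> v" "s \<noteq> z" using s one loop by auto
      have zv: "{z, v} \<in> E" using twins[of z] z zu by (simp add: insert_commute)
      \<comment> \<open>Both units move to \<open>z\<close>, which now dominates \<open>u\<close>
        and \<open>v\<close>. Having value 1, these dominated nothing before, and their other
        neighbours had value 0, so no remaining positive vertex relied on them.\<close>
      let ?h = "f(u := 0, v := 0, z := 2)"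
      have "TRD_function V (E - {{u, v}}) ?h"
      proof (rule TRD_functionI)
        fix a assume "a \<in> V"
        then show "?h a \<le> 2" using TRD_function_le_2[OF f] by simp
      next
        fix a assume a: "a \<in> V" "?h a = 0"
        then have az: "a \<noteq> z" by (auto split: if_splits)
        show "\<exists>t\<in>V. {t, a} \<in> E - {{u, v}} \<and> ?h t = 2"
        proof (cases "a = u \<or> a = v")
          case True
          then show ?thesis using z zv zu
            by (intro bexI[of _ z]) (auto simp: doubleton_eq_iff insert_commute)
        next
          case False
          then have "f a = 0" using a az by simp
          then obtain t where t: "t \<in> V" "{t, a} \<in> E" "f t = 2"
            using f a TRD_function_zeroE by metis
          then have "t \<noteq> u" "t \<noteq> v" using one by auto
          then show ?thesis using t False by (intro bexI[of _ t]) (auto simp: doubleton_eq_iff)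
        qed
      next
        fix a assume a: "a \<in> V" "0 < ?h a"
        then have ane: "a \<noteq> u" "a \<noteq> v" using z zu by (auto split: if_splits)
        show "\<exists>t\<in>V. {t, a} \<in> E - {{u, v}} \<and> 0 < ?h t"
        proof (cases "a = z")
          case True
          then show ?thesis using s sne by (intro bexI[of _ s]) (auto simp: doubleton_eq_iff)
        next
          case False
          then have pos: "0 < f a" using a ane by simp
          then obtain t where t: "t \<in> V" "{t, a} \<in> E" "0 < f t"
            using f a TRD_function_posE by metis
          then have "t \<noteq> u" "t \<noteq> v" using zero[of a] zero'[of a] a ane pos by auto
          then show ?thesis using t ane by (intro bexI[of _ t]) (auto simp: doubleton_eq_iff)
        qed
      qed
      moreover have "weight V ?h \<le> weight V f"
        using weight_upd[OF fin uv(1), of f 0] weight_upd[OF fin uv(2), of "f(u := 0)" 0]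
          weight_upd[OF fin z(1), of "f(u := 0, v := 0)" 2] one uv(3) by simp
      ultimately show ?thesis by blast
    qed
  qed
qed

section \<open>Combining the configurations\<close>

text \<open>The form in which the degree hypothesis enters: it provides a neighbour still available
  once \<open>uv\<close> is removed.\<close>

lemma second_neighbour:
  assumes graph: "fin_simple_graph V E"
    and uv: "{u, v} \<in> E" "vdegree E v \<noteq> 1"
  obtains z where "z \<in> V" "{z, v} \<in> E" "z \<noteq> u"
proof -
  have "{e \<in> E. v \<in> e} \<noteq> {{u, v}}"
  proof
    assume "{e \<in> E. v \<in> e} = {{u, v}}"
    then have "vdegree E v = 1" unfolding vdegree_def by simp
    then show False using uv(2) by simp
  qed
  then obtain e where e: "e \<in> E" "v \<in> e" "e \<noteq> {u, v}" using uv(1) by blast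
  then have "e \<subseteq> V" "card e = 2" using graph by (auto simp: fin_simple_graph_def all_pairs_def)
  then obtain z where "e = {z, v}" using e(2) by (auto simp: card_2_iff)
  then show thesis using that[of z] e \<open>e \<subseteq> V\<close> by auto
qed

theorem theorem9p3:
  fixes V :: "'a set" and E :: "'a set set" and e :: "'a set"
  assumes "edge_supercritical V E"
    and "e \<in> E"
    and "\<forall>v\<in>e. vdegree E v \<noteq> 1"
  shows "gamma_tR V (E - {e}) = gamma_tR V E"
proof -
  have graph: "fin_simple_graph V E" and iso: "no_isolated V E"
    using assms(1) by (auto simp: edge_supercritical_def)
  have "card e = 2" "e \<subseteq> V" using graph assms(2) by (auto simp: fin_simple_graph_def all_pairs_def)
  then obtain u v where e: "e = {u, v}" and uv: "u \<in> V" "v \<in> V" "u \<noteq> v" "{u, v} \<in> E"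
    using assms(2) by (auto simp: card_2_iff)
  have vu: "{v, u} \<in> E" using uv by (simp add: insert_commute)
  obtain z where z: "z \<in> V" "{z, v} \<in> E" "z \<noteq> u"
    using second_neighbour[OF graph uv(4)] assms(3) e by auto
  obtain y where y: "y \<in> V" "{y, u} \<in> E" "y \<noteq> v"
    using second_neighbour[OF graph vu] assms(3) e by auto
  have "\<exists>f. TRD_function V (E - {e}) f \<and> weight V f \<le> gamma_tR V E"
  proof (cases "\<exists>w\<in>V. w \<noteq> u \<and> w \<noteq> v \<and> ({u, w} \<in> E \<longleftrightarrow> {v, w} \<notin> E)")
    case True
    then obtain w where w: "w \<in> V" "w \<noteq> u" "w \<noteq> v" "{u, w} \<in> E \<longleftrightarrow> {v, w} \<notin> E" by blast
    show ?thesis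
    proof (cases "{u, w} \<in> E")
      case True
      then show ?thesis
        using supercritical_remove_edge_non_twins[OF assms(1) uv w(1) _ _ w(3) z] w(4) e
        by (simp add: insert_commute)
    \<comment> \<open>The same argument with \<open>u\<close> and \<open>v\<close> exchanged;
      \<open>y\<close> now plays the part of \<open>z\<close>.\<close>
    next
      case False
      then show ?thesis
        using supercritical_remove_edge_non_twins[OF assms(1) uv(2,1) uv(3)[symmetric] vu w(1) _ _ w(2) y]
          w(4) e
        by (simp add: insert_commute)
    qed
  next
    case False
    then have twins: "{u, w} \<in> E \<longleftrightarrow> {v, w} \<in> E" if "w \<in> V" "w \<noteq> u" "w \<noteq> v" for w
      using that by blast
    have loop: "{x} \<notin> E" for x using graph by (auto simp: fin_simple_graph_def all_pairs_def)
    show ?thesis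
    proof (cases "\<forall>a\<in>V. \<forall>b\<in>V. a \<noteq> b \<longrightarrow> {u, a} \<in> E \<longrightarrow> {u, b} \<in> E \<longrightarrow> {a, b} \<in> E")
      case True
      obtain f where f: "TRD_function V E f" "weight V f = gamma_tR V E"
        using TRD_function_one[OF iso] by (rule gamma_tR_attained)
      have "{u, y} \<in> E" using y by (simp add: insert_commute)
      from remove_edge_clique[OF graph uv y(1) this y(3) twins _ f(1)] True
      show ?thesis using f(2) e by auto
    next
      case False
      then obtain a b where ab: "a \<in> V" "b \<in> V" "a \<noteq> b" "{u, a} \<in> E" "{u, b} \<in> E" "{a, b} \<notin> E"
        by blast
      have "a \<noteq> u" "b \<noteq> u" using ab loop by auto
      \<comment> \<open>A nonadjacent pair of neighbours of \<open>u\<close> cannot contain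
        \<open>v\<close>, since every other neighbour of \<open>u\<close> is adjacent to
        \<open>v\<close> by \<open>twins\<close>.\<close>
      moreover have "a \<noteq> v" "b \<noteq> v"
        using ab twins[of a] twins[of b] \<open>a \<noteq> u\<close> \<open>b \<noteq> u\<close> by (auto simp: insert_commute)
      ultimately show ?thesis
        using supercritical_remove_edge_nonadjacent_common_neighbours
          [OF assms(1) uv ab(1,4) _ ab(2,5) _ ab(3,6)] twins ab e by blast
    qed
  qed
  then obtain f where f: "TRD_function V (E - {e}) f" "weight V f \<le> gamma_tR V E" by blast
  \<comment> \<open>The function \<open>f\<close> gives one inequality and also shows that the
    minimum for \<open>G - e\<close> is attained. A minimiser there remains valid in
    \<open>G\<close>, which gives the other inequality.\<close>
  obtain g where g: "TRD_function V (E - {e}) g" "weight V g = gamma_tR V (E - {e})"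
    using f(1) by (rule gamma_tR_attained)
  have "TRD_function V E g" using g(1) by (rule TRD_function_mono) auto
  then have "gamma_tR V E \<le> gamma_tR V (E - {e})" using gamma_tR_le g(2) by metis
  then show ?thesis using gamma_tR_le[OF f(1)] f(2) by simp
qed

end
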